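(* Let $(b_n)_{n\ge 1}$ be a strictly increasing sequence of positive integers, put $a_n = 1/b_n$, and suppose that $\sum_{n\ge 1} a_n = +\infty$. Suppose that $n \le b_n \le n B(n)$ for all $n\ge 2$, where $B(n) = n^{\beta(n)}$ and $\beta$ is a real-valued decreasing function with $\beta(n) = o(1)$ as $n\to\infty$, and that $$\beta(n) \le \frac{1}{8\log\log n}\qquad\text{for all sufficiently large } n.$$ Then there exists $C>0$ such that for every $\tau\in\mathbb{R}$ we have $$\mathfrak{m}_N(\tau) < \exp(-C\log^2 N)$$ for all sufficiently large $N$ depending on $\tau$.
   Context: For $N\in\mathbb{N}=\{1,2,3,\dots\}$ and $\tau\in\mathbb{R}$, $$\mathfrak{m}_N(\tau) = \min\Bigl\{ \Bigl|\sum_{n=1}^N s_n a_n - \tau\Bigr| : s_n\in\{-1,1\} \text{ for } n=1,\dots,N\Bigr\}.$$ Here $\log^2 N = (\log N)^2$. *)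

theory Defs
  imports Complex_Main "HOL-Library.FuncSet"
begin

(* Sequences are indexed from 1, so the value a 0 plays no role. The index set of sign
   choices is finite and nonempty, so Min is a genuine minimum. *)
definition signed_sum_min :: "(nat \<Rightarrow> real) \<Rightarrow> nat \<Rightarrow> real \<Rightarrow> real" where
  "signed_sum_min a N \<tau> =
     Min ((\<lambda>s. \<bar>(\<Sum>n=1..N. s n * a n) - \<tau>\<bar>) ` ({1..N} \<rightarrow>\<^sub>E {-1, 1}))"

end

(*
  Fix the signs of the first M terms greedily, so that the remainder x satisfies |x| <= a M <= 1/M,
  and average over the remaining signs: the mean of exp (i t (sum of s n * a n)) is the product
  P t of the cos (t a n), M < n <= N. Testing against the Fejer kernel of cutoff
  T = exp (3 C (ln N)^2), a minimal distance of at least exp (- C (ln N)^2) would force the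
  integral of (1 - t/T) P t cos (t x) over [0, T] to be tiny. It is at least 1/16: the integrand is
  nonnegative on [0, M], and |P t| <= 1/t^2 on [M, T].

  For t <= N/2 the decay of P comes from the n in (t, 2t]. For larger t, cos (t / b n) is close
  to 1 in modulus only if b n divides an integer m near t / pi, and m <= T has few divisors up
  to b N. Rankin's trick with exponent 1/2 - 2 / ln ln N bounds their number by
  sqrt N * exp (- c ln N / ln ln N), provided C is small; this saving absorbs the factor B N.
*)
theory Submission
  imports Defs "HOL-Analysis.Analysis" "HOL-Computational_Algebra.Primes" "HOL-Real_Asymp.Real_Asymp"
begin

section \<open>Elementary bounds for sine and cosine\<close>

lemma abs_sin_ge_half:
  fixes x :: real
  assumes "\<bar>x\<bar> \<le> pi / 2"
  shows "\<bar>x\<bar> / 2 \<le> \<bar>sin x\<bar>"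
proof -
  have pos: "y / 2 \<le> sin y" if "0 \<le> y" "y \<le> pi / 2" for y :: real
  proof -
    \<comment> \<open>The rational bound 8/5 for pi/2 is sharp enough: (8/5)^2 < 3 is what makes y -
      y^3/6 at least y/2.\<close>
    have "y \<le> 8 / 5" using that pi_less_4 pi_approx by simp
    have "y^2 \<le> (8/5)^2" using that \<open>y \<le> 8/5\<close> by (intro power_mono) auto
    then have "y * y^2 \<le> y * 3" using that by (intro mult_left_mono) (auto simp: power2_eq_square)
    then have "y / 2 \<le> y - y^3 / 6" by (simp add: power2_eq_square power3_eq_cube)
    also have "\<dots> \<le> sin y"
    proof -
      have "\<bar>sin y - y\<bar> \<le> y^3 / 6"
        using Maclaurin_sin_bound[of y 3] that by (simp add: eval_nat_numeral sin_coeff_def)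
      then show ?thesis by linarith
    qed
    finally show ?thesis .
  qed
  show ?thesis
    using pos[of x] pos[of "-x"] assms by (cases "x \<ge> 0") auto
qed

lemma abs_cos_le_exp:
  fixes x :: real
  shows "\<bar>cos x\<bar> \<le> exp (- (sin x)\<^sup>2 / 2)"
proof -
  have "(cos x)\<^sup>2 = 1 - (sin x)\<^sup>2" by (simp add: cos_squared_eq)
  also have "\<dots> \<le> exp (- (sin x)\<^sup>2)" using exp_ge_add_one_self[of "- (sin x)\<^sup>2"] by simp
  also have "\<dots> = (exp (- (sin x)\<^sup>2 / 2))\<^sup>2" by (simp flip: exp_double)
  finally have "\<bar>cos x\<bar>\<^sup>2 \<le> (exp (- (sin x)\<^sup>2 / 2))\<^sup>2" by simp
  then show ?thesis by (rule power2_le_imp_le) simp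
qed

text \<open>Since |cos| has period pi, x may be replaced by its offset y from the nearest multiple
  of pi. There |sin y| >= |y|/2 >= d/2, and the bound exp (- (sin y)^2 / 2) yields the constant 8 =
  2 * 2^2.\<close>

lemma abs_cos_le_exp_dist:
  fixes x d :: real
  assumes "0 \<le> d" and "\<And>k::int. d \<le> \<bar>x - of_int k * pi\<bar>"
  shows "\<bar>cos x\<bar> \<le> exp (- d\<^sup>2 / 8)"
proof -
  define k where "k = round (x / pi)"
  define y where "y = x - of_int k * pi"
  have "\<bar>x / pi - of_int k\<bar> \<le> 1/2"
    unfolding k_def using of_int_round_abs_le[of "x / pi"] by (simp add: abs_minus_commute)
  moreover have "y = (x / pi - of_int k) * pi" by (simp add: y_def field_simps)
  ultimately have "\<bar>y\<bar> \<le> pi / 2" by (simp add: abs_mult)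
  then have "\<bar>y\<bar> / 2 \<le> \<bar>sin y\<bar>" by (rule abs_sin_ge_half)
  moreover have "d \<le> \<bar>y\<bar>" using assms(2)[of k] by (simp add: y_def)
  ultimately have "d / 2 \<le> \<bar>sin y\<bar>" by linarith
  then have "(d / 2)\<^sup>2 \<le> (sin y)\<^sup>2" using assms(1) by (metis abs_le_square_iff abs_of_nonneg divide_nonneg_pos zero_less_numeral)
  moreover have "\<bar>cos x\<bar> = \<bar>cos y\<bar>"
    by (simp add: y_def cos_diff mult.commute[of _ pi])
  ultimately show ?thesis using abs_cos_le_exp[of y] by (force simp: power_divide elim: order_trans)
qed

section \<open>Chebyshev-type bounds for sums over primes\<close>

lemma prod_primes_dvd:
  fixes n :: nat
  assumes "finite P" "\<And>p. p \<in> P \<Longrightarrow> prime p \<and> p dvd n"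
  shows "\<Prod>P dvd n"
  using assms
proof (induction P rule: finite_induct)
  case (insert p P)
  then have "coprime p (\<Prod>P)" by (intro prod_coprime_right) (auto intro!: primes_coprime)
  then show ?case using insert by (auto intro!: divides_mult)
qed simp

text \<open>Chebyshev's argument: each prime in (n, 2n] divides (2n)! but not n!, so the product of
  these primes divides the central binomial coefficient, which is at most 4^n.\<close>

lemma sum_ln_primes_dyadic_le:
  fixes n :: nat
  shows "(\<Sum>p | prime p \<and> n < p \<and> p \<le> 2 * n. ln (real p)) \<le> real n * ln 4"
proof -
  let ?P = "{p. prime p \<and> n < p \<and> p \<le> 2 * n}"
  have fin: "finite ?P" by (rule finite_subset[of _ "{..2*n}"]) auto
  have dvd: "p dvd (2 * n choose n)" if "p \<in> ?P" for p
  proof -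
    have "fact n * fact n * (2 * n choose n) = (fact (2 * n) :: nat)"
      using binomial_fact_lemma[of n "2 * n"] by (simp add: mult_2)
    moreover have "p dvd fact (2 * n)" "\<not> p dvd fact n"
      using that by (auto simp: prime_dvd_fact_iff)
    ultimately show ?thesis using that by (metis mem_Collect_eq prime_dvd_mult_iff)
  qed
  have "\<Prod>?P dvd (2 * n choose n)"
    using fin dvd by (intro prod_primes_dvd) auto
  then have "\<Prod>?P \<le> (2 * n choose n)" by (intro dvd_imp_le) auto
  also have "\<dots> \<le> 2 ^ (2 * n)" by (rule binomial_le_pow2)
  finally have le: "\<Prod>?P \<le> 4 ^ n" by (simp add: power_mult)
  have "(\<Sum>p\<in>?P. ln (real p)) = ln (\<Prod>p\<in>?P. real p)"
    using fin by (intro ln_prod[symmetric]) (auto dest: prime_gt_0_nat)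
  also have "(\<Prod>p\<in>?P. real p) = real (\<Prod>?P)" by simp
  also have "ln \<dots> \<le> ln (real (4 ^ n))"
    using le fin by (subst ln_le_cancel_iff) (auto intro!: prod_pos dest: prime_gt_0_nat simp: of_nat_le_iff simp del: of_nat_prod of_nat_power)
  finally show ?thesis by (simp add: ln_realpow)
qed

text \<open>Dyadic induction instead of partial summation: on the block (2^k, 2^(k+1)] the weight 1
  / sqrt p is at most 1 / sqrt (2^k), so the block adds at most ln 4 * sqrt (2^k). The constant 4
  closes the induction because ln 4 <= 8/5 and 4 + 8/5 = 4 * 7/5 <= 4 * sqrt 2.\<close>

lemma sum_ln_primes_div_sqrt_pow2_le:
  "(\<Sum>p | prime p \<and> p \<le> 2 ^ k. ln (real p) / sqrt (real p)) \<le> 4 * sqrt (2 ^ k)"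
proof (induction k)
  case 0
  have "{p::nat. prime p \<and> p \<le> 2 ^ 0} = {}" by (auto dest: prime_gt_1_nat)
  then show ?case by (simp only: sum.empty) simp
next
  case (Suc k)
  let ?f = "\<lambda>p::nat. ln (real p) / sqrt (real p)"
  let ?P = "{p. prime p \<and> (2::nat) ^ k < p \<and> p \<le> 2 * 2 ^ k}"
  have "sum ?f ?P \<le> (\<Sum>p\<in>?P. ln (real p) / sqrt (2 ^ k))"
  proof (rule sum_mono)
    fix p assume p: "p \<in> ?P"
    then have "real (2 ^ k) \<le> real p" by (intro of_nat_mono) auto
    then show "?f p \<le> ln (real p) / sqrt (2 ^ k)"
      using p by (intro divide_left_mono) (auto dest: prime_gt_0_nat)
  qed
  also have "\<dots> = (\<Sum>p\<in>?P. ln (real p)) / sqrt (2 ^ k)" by (rule sum_divide_distrib[symmetric])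
  also have "\<dots> \<le> (2 ^ k * ln 4) / sqrt (2 ^ k)"
    using sum_ln_primes_dyadic_le[of "2 ^ k"] by (intro divide_right_mono) auto
  also have "\<dots> = ln 4 * sqrt (2 ^ k)" by (simp add: real_div_sqrt field_simps)
  also have "\<dots> \<le> 8/5 * sqrt (2 ^ k)"
  proof (rule mult_right_mono)
    have "2 \<le> exp (4/5 :: real)" using exp_lower_Taylor_quadratic[of "4/5"] by (simp add: power2_eq_square)
    then have "ln 2 \<le> (4/5 :: real)" by (metis exp_le_cancel_iff exp_ln zero_less_numeral)
    then show "ln 4 \<le> (8/5 :: real)" using ln_realpow[of 2 2] by simp
  qed simp
  finally have dyadic: "sum ?f ?P \<le> 8/5 * sqrt (2 ^ k)" .
  have "{p::nat. prime p \<and> p \<le> 2 ^ Suc k} = {p. prime p \<and> p \<le> 2 ^ k} \<union> ?P" by auto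
  then have "(\<Sum>p | prime p \<and> p \<le> 2 ^ Suc k. ?f p) = (\<Sum>p | prime p \<and> p \<le> 2 ^ k. ?f p) + sum ?f ?P"
    by (simp, subst sum.union_disjoint) (auto intro: finite_subset[of _ "{..2*2^k}"])
  then have "(\<Sum>p | prime p \<and> p \<le> 2 ^ Suc k. ?f p) \<le> (4 + 8/5) * sqrt (2 ^ k)"
    using Suc dyadic by (simp only: distrib_right)
  also have "\<dots> \<le> 4 * sqrt 2 * sqrt (2 ^ k)"
  proof (rule mult_right_mono)
    have "7/5 \<le> sqrt 2" by (rule real_le_rsqrt) (simp add: power2_eq_square)
    then show "4 + 8/5 \<le> 4 * sqrt 2" by simp
  qed simp
  also have "\<dots> = 4 * sqrt (2 ^ Suc k)" by (simp add: real_sqrt_mult)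
  finally show ?case .
qed

lemma sum_ln_primes_div_sqrt_le:
  fixes x :: real
  assumes "1 \<le> x"
  shows "(\<Sum>p | prime p \<and> real p \<le> x. ln (real p) / sqrt (real p)) \<le> 6 * sqrt x"
proof -
  \<comment> \<open>The least power of two that is at least x is at most 2x, so rounding up costs a
    factor sqrt 2, and 4 * sqrt 2 <= 6.\<close>
  define k where "k = nat \<lceil>log 2 x\<rceil>"
  have "log 2 x \<ge> 0" using assms by simp
  then have k: "log 2 x \<le> real k" "real k \<le> log 2 x + 1" unfolding k_def by linarith+
  have "x = 2 powr log 2 x" using assms by simp
  also have "\<dots> \<le> 2 powr real k" using k by simp
  finally have x1: "x \<le> 2 ^ k" by (simp add: powr_realpow)
  have "(2::real) ^ k = 2 powr real k" by (simp add: powr_realpow)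
  also have "\<dots> \<le> 2 powr (log 2 x + 1)" using k by simp
  also have "\<dots> = 2 * x" using assms by (simp add: powr_add)
  finally have x2: "2 ^ k \<le> 2 * x" .
  have "(\<Sum>p | prime p \<and> real p \<le> x. ln (real p) / sqrt (real p)) \<le>
        (\<Sum>p | prime p \<and> p \<le> 2 ^ k. ln (real p) / sqrt (real p))"
  proof (rule sum_mono2)
    show "finite {p::nat. prime p \<and> p \<le> 2 ^ k}" by (rule finite_subset[of _ "{..2^k}"]) auto
    show "{p::nat. prime p \<and> real p \<le> x} \<subseteq> {p. prime p \<and> p \<le> 2 ^ k}"
    proof clarify
      fix p :: nat assume "real p \<le> x"
      moreover have "real (2 ^ k) = 2 ^ k" by simp
      ultimately have "real p \<le> real (2 ^ k)" using x1 by linarith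
      then show "p \<le> 2 ^ k" unfolding of_nat_le_iff .
    qed
  qed (auto dest: prime_gt_0_nat simp: Suc_le_eq)
  also have "\<dots> \<le> 4 * sqrt (2 ^ k)" by (rule sum_ln_primes_div_sqrt_pow2_le)
  also have "\<dots> \<le> 4 * sqrt (2 * x)" using x2 by simp
  also have "\<dots> \<le> 6 * sqrt x"
  proof -
    have "sqrt 2 \<le> 3/2" by (intro real_le_lsqrt) (auto simp: power2_eq_square)
    then have "4 * sqrt 2 * sqrt x \<le> 6 * sqrt x" using assms by (intro mult_right_mono) auto
    then show ?thesis by (simp add: real_sqrt_mult)
  qed
  finally show ?thesis .
qed

lemma sum_inverse_sqrt_le:
  "(\<Sum>n=1..k. 1 / sqrt (real n)) \<le> 2 * sqrt (real k)"
proof (induction k)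
  case (Suc k)
  have "1 / sqrt (real (Suc k)) \<le> 2 * (sqrt (real (Suc k)) - sqrt (real k))"
  proof -
    define u v where "u = sqrt (real (Suc k))" and "v = sqrt (real k)"
    have uv: "u > 0" "v \<ge> 0" "u \<ge> v" "u^2 - v^2 = 1" by (auto simp: u_def v_def)
    have "1 = (u - v) * (u + v)" using uv by (simp add: algebra_simps power2_eq_square)
    also have "\<dots> \<le> (u - v) * (2 * u)" using uv by (intro mult_left_mono) auto
    finally show ?thesis using uv(1) unfolding u_def[symmetric] v_def[symmetric] by (simp add: field_simps)
  qed
  then show ?case using Suc by simp
qed simp

section \<open>Counting small divisors by Rankin's trick\<close>

lemma sum_divisors_powr_mult_le:
  fixes a b :: nat and s :: real
  assumes "a > 0" "b > 0"
  shows "(\<Sum>d | d dvd a * b. real d powr s) \<le> (\<Sum>d | d dvd a. real d powr s) * (\<Sum>d | d dvd b. real d powr s)"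
proof -
  let ?D = "{d. d dvd a} \<times> {d. d dvd b}"
  have fin: "finite ?D" using assms by auto
  \<comment> \<open>Without coprimality a divisor of a * b may factor in several ways. The map from
    pairs to products is still onto the divisors, which suffices for an upper bound.\<close>
  have "{d. d dvd a * b} \<subseteq> (\<lambda>(x, y). x * y) ` ?D"
  proof
    fix d assume "d \<in> {d. d dvd a * b}"
    then obtain x y where "d = x * y" "x dvd a" "y dvd b" using division_decomp[of d a b] by auto
    then show "d \<in> (\<lambda>(x, y). x * y) ` ?D" by auto
  qed
  then have "(\<Sum>d | d dvd a * b. real d powr s) \<le> (\<Sum>d\<in>(\<lambda>(x, y). x * y) ` ?D. real d powr s)"
    using fin by (intro sum_mono2) auto
  also have "\<dots> \<le> (\<Sum>z\<in>?D. real (case z of (x, y) \<Rightarrow> x * y) powr s)"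
    using fin by (intro sum_image_le[of _ "\<lambda>d. real d powr s" "\<lambda>(x,y). x * y", unfolded o_def]) auto
  also have "\<dots> = (\<Sum>(x, y)\<in>?D. real x powr s * real y powr s)"
    by (intro sum.cong) (auto simp: powr_mult)
  also have "\<dots> = (\<Sum>d | d dvd a. real d powr s) * (\<Sum>d | d dvd b. real d powr s)"
    by (simp add: sum_product sum.cartesian_product)
  finally show ?thesis .
qed

text \<open>A geometric series with ratio x = p powr (-\<sigma>). From \<sigma> >= 1/4 and p >= 2
  the ratio stays below 2 powr (-1/4) <= 6/7, so 1 / (1 - x) <= 1 + 7 x <= exp (7 x).\<close>

lemma sum_divisors_powr_prime_power_le:
  fixes p k :: nat and \<sigma> :: real
  assumes "prime p" "1/4 \<le> \<sigma>"
  shows "(\<Sum>d | d dvd p ^ k. real d powr (-\<sigma>)) \<le> exp (7 * real p powr (-\<sigma>))"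
proof -
  define x where "x = real p powr (-\<sigma>)"
  have p2: "real p \<ge> 2" using prime_ge_2_nat[OF assms(1)] by simp
  have "x \<le> real p powr (-(1/4))" unfolding x_def using p2 assms by (intro powr_mono) auto
  also have "\<dots> \<le> 2 powr (-(1/4))" using p2 by (intro powr_mono2') auto
  also have "\<dots> \<le> 6/7"
  proof -
    have "(7/6) powr 4 \<le> (2::real)" by (simp add: powr_numeral power_divide)
    then have "((7/6::real) powr 4) powr (1/4) \<le> 2 powr (1/4)" by (intro powr_mono2) auto
    then have "7/6 \<le> (2::real) powr (1/4)" unfolding powr_powr by simp
    then show ?thesis by (simp add: powr_minus field_simps)
  qed
  finally have x: "x \<le> 6/7" "x > 0" using p2 by (auto simp: x_def)
  have "{d. d dvd p ^ k} = (\<lambda>i. p ^ i) ` {..k}"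
    using assms(1) by (auto simp: divides_primepow_nat)
  moreover have "inj_on (\<lambda>i. p ^ i) {..k}"
    using prime_gt_1_nat[OF assms(1)] by (auto intro!: inj_onI)
  ultimately have "(\<Sum>d | d dvd p ^ k. real d powr (-\<sigma>)) = (\<Sum>i\<le>k. real (p ^ i) powr (-\<sigma>))"
    by (simp add: sum.reindex)
  also have "\<dots> = (\<Sum>i\<le>k. x ^ i)"
    using p2 by (intro sum.cong) (auto simp: x_def powr_powr mult.commute simp flip: powr_realpow)
  also have "\<dots> \<le> 1 / (1 - x)"
    using x by (simp add: sum_gp0 divide_right_mono)
  also have "\<dots> = 1 + x / (1 - x)" using x by (simp add: field_simps)
  also have "\<dots> \<le> 1 + 7 * x" using x by (simp add: field_simps mult_left_mono)
  also have "\<dots> \<le> exp (7 * x)" by (rule exp_ge_add_one_self)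
  finally show ?thesis by (simp add: x_def)
qed

text \<open>A finite Euler product bound: the prime powers of m are split off one at a time, and
  each contributes one summand to the exponent.\<close>

lemma sum_divisors_powr_le:
  fixes m :: nat and \<sigma> :: real
  assumes "m > 0" "1/4 \<le> \<sigma>"
  shows "(\<Sum>d | d dvd m. real d powr (-\<sigma>)) \<le> exp (7 * (\<Sum>p\<in>prime_factors m. real p powr (-\<sigma>)))"
proof -
  have "(\<Sum>d | d dvd (\<Prod>p\<in>S. p ^ multiplicity p m). real d powr (-\<sigma>)) \<le> exp (7 * (\<Sum>p\<in>S. real p powr (-\<sigma>)))"
    if "finite S" "S \<subseteq> prime_factors m" for S
    using that
  proof (induction S rule: finite_induct)
    case (insert p S)
    let ?F = "\<lambda>n. \<Sum>d | d dvd n. real d powr (-\<sigma>)"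
    let ?r = "\<Prod>p\<in>S. p ^ multiplicity p m"
    have p: "prime p" using insert by auto
    have "?F (p ^ multiplicity p m * ?r) \<le> ?F (p ^ multiplicity p m) * ?F ?r"
      using insert by (intro sum_divisors_powr_mult_le prod_pos) (auto intro!: prime_factors_gt_0_nat)
    also have "\<dots> \<le> exp (7 * real p powr (-\<sigma>)) * exp (7 * (\<Sum>p\<in>S. real p powr (-\<sigma>)))"
      using insert p assms by (intro mult_mono sum_divisors_powr_prime_power_le) (auto intro: sum_nonneg)
    finally show ?case using insert by (simp add: exp_add algebra_simps)
  qed simp
  from this[of "prime_factors m"] show ?thesis
    using assms(1) by (simp add: prime_factorization_nat[symmetric])
qed

lemma card_divisors_le:
  fixes m :: nat and \<sigma> X :: real
  assumes "m > 0" "1/4 \<le> \<sigma>"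
  shows "real (card {d. d dvd m \<and> real d \<le> X}) \<le> X powr \<sigma> * exp (7 * (\<Sum>p\<in>prime_factors m. real p powr (-\<sigma>)))"
proof -
  have "real (card {d. d dvd m \<and> real d \<le> X}) = (\<Sum>d | d dvd m \<and> real d \<le> X. 1)" by simp
  also have "\<dots> \<le> (\<Sum>d | d dvd m \<and> real d \<le> X. X powr \<sigma> * real d powr (-\<sigma>))"
  proof (rule sum_mono)
    fix d assume "d \<in> {d. d dvd m \<and> real d \<le> X}"
    then have d: "d > 0" "real d \<le> X" using assms(1) by (auto intro!: Nat.gr0I)
    then have "real d powr \<sigma> \<le> X powr \<sigma>" using assms by (intro powr_mono2) auto
    then show "1 \<le> X powr \<sigma> * real d powr (-\<sigma>)" using d by (simp add: powr_minus field_simps)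
  qed
  also have "\<dots> \<le> (\<Sum>d | d dvd m. X powr \<sigma> * real d powr (-\<sigma>))"
    using assms by (intro sum_mono2) auto
  also have "\<dots> = X powr \<sigma> * (\<Sum>d | d dvd m. real d powr (-\<sigma>))" by (simp add: sum_distrib_left)
  also have "\<dots> \<le> X powr \<sigma> * exp (7 * (\<Sum>p\<in>prime_factors m. real p powr (-\<sigma>)))"
    using assms by (intro mult_left_mono sum_divisors_powr_le) auto
  finally show ?thesis .
qed

lemma sum_ln_prime_factors_le:
  fixes m :: nat
  assumes "m > 0"
  shows "(\<Sum>p\<in>prime_factors m. ln (real p)) \<le> ln (real m)"
proof -
  have "(\<Sum>p\<in>prime_factors m. ln (real p)) = ln (\<Prod>p\<in>prime_factors m. real p)"
    by (intro ln_prod[symmetric]) (auto dest: prime_factors_gt_0_nat)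
  also have "(\<Prod>p\<in>prime_factors m. real p) = real (\<Prod>(prime_factors m))" by simp
  also have "ln \<dots> \<le> ln (real m)"
  proof -
    have "\<Prod>(prime_factors m) dvd m"
      by (intro prod_primes_dvd) (auto simp: prime_factors_dvd assms)
    then have "\<Prod>(prime_factors m) \<le> m" using assms by (intro dvd_imp_le) auto
    then show ?thesis
      using assms by (subst ln_le_cancel_iff) (auto intro!: prod_pos dest: prime_factors_gt_0_nat simp del: of_nat_prod)
  qed
  finally show ?thesis .
qed

text \<open>Three ranges of primes. Up to w all integers are counted, giving 2 * sqrt w. In (w, z]
  the factor ln p / ln w >= 1 is inserted to reach the Chebyshev sum. In both cases p powr (1/2 -
  \<sigma>) is bounded by its value at z. Above z the factor ln p / ln z >= 1 is inserted, and the
  logarithms of the prime factors add up to at most ln m.\<close>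

lemma sum_prime_factors_powr_le:
  fixes m :: nat and \<sigma> w z :: real
  assumes "m > 0" "0 \<le> \<sigma>" "\<sigma> \<le> 1/2" "1 < w" "w \<le> z"
  shows "(\<Sum>p\<in>prime_factors m. real p powr (-\<sigma>)) \<le>
    z powr (1/2 - \<sigma>) * (2 * sqrt w + 6 * sqrt z / ln w) + z powr (-\<sigma>) * (ln (real m) / ln z)"
proof -
  let ?P = "prime_factors m"
  let ?f = "\<lambda>p. if real p \<le> w then 1 / sqrt (real p) else 0"
  let ?g = "\<lambda>p. if real p \<le> z then ln (real p) / sqrt (real p) else 0"
  have lnw: "ln w > 0" "ln z > 0" using assms by auto
  have pt: "real p powr (-\<sigma>) \<le>
      z powr (1/2 - \<sigma>) * (?f p + ?g p / ln w) + z powr (-\<sigma>) * (ln (real p) / ln z)"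
    if "p \<in> ?P" for p
  proof -
    have p2: "real p \<ge> 2" using that prime_ge_2_nat[of p] by (auto simp: prime_factors_dvd)
    have nn: "?f p \<ge> 0" "?g p / ln w \<ge> 0" "ln (real p) / ln z \<ge> 0" using lnw p2 by auto
    show ?thesis
    proof (cases "real p \<le> z")
      case True
      have "real p powr (-\<sigma>) = real p powr (1/2 - \<sigma>) * real p powr (-(1/2))"
        by (simp flip: powr_add)
      also have "\<dots> \<le> z powr (1/2 - \<sigma>) * (?f p + ?g p / ln w)"
      proof (rule mult_mono)
        show "real p powr (1/2 - \<sigma>) \<le> z powr (1/2 - \<sigma>)"
          using True p2 assms by (intro powr_mono2) auto
        have "real p powr (-(1/2)) = 1 / sqrt (real p)"
          using p2 by (simp add: powr_minus powr_half_sqrt inverse_eq_divide)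
        also have "\<dots> \<le> ?f p + ?g p / ln w"
        proof (cases "real p \<le> w")
          case True
          then show ?thesis using nn(2) by simp
        next
          case False
          then have "1 \<le> ln (real p) / ln w" using lnw assms by simp
          then have "1 / sqrt (real p) \<le> (ln (real p) / ln w) / sqrt (real p)" by (intro divide_right_mono) auto
          then show ?thesis using False True by (simp add: mult.commute)
        qed
        finally show "real p powr (-(1/2)) \<le> ?f p + ?g p / ln w" .
      qed auto
      finally show ?thesis
        using mult_nonneg_nonneg[OF powr_ge_zero[of z "-\<sigma>"] nn(3)] by linarith
    next
      case False
      have "1 \<le> ln (real p) / ln z" using lnw assms False by simp
      moreover have "real p powr (-\<sigma>) \<le> z powr (-\<sigma>)" using False assms by (intro powr_mono2') auto
      ultimately have "real p powr (-\<sigma>) * 1 \<le> z powr (-\<sigma>) * (ln (real p) / ln z)" by (intro mult_mono) auto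
      then show ?thesis using False assms by simp
    qed
  qed
  have f: "sum ?f ?P \<le> 2 * sqrt w"
  proof -
    have "sum ?f ?P = (\<Sum>p\<in>?P \<inter> {p. real p \<le> w}. 1 / sqrt (real p))"
      by (simp add: sum.inter_restrict)
    also have "\<dots> \<le> (\<Sum>n=1..nat \<lfloor>w\<rfloor>. 1 / sqrt (real n))"
      by (intro sum_mono2) (auto simp: le_nat_floor Suc_le_eq dest: prime_factors_gt_0_nat)
    also have "\<dots> \<le> 2 * sqrt (real (nat \<lfloor>w\<rfloor>))" by (rule sum_inverse_sqrt_le)
    also have "\<dots> \<le> 2 * sqrt w" using assms by (simp add: of_nat_floor)
    finally show ?thesis .
  qed
  have g: "sum ?g ?P \<le> 6 * sqrt z"
  proof -
    have "sum ?g ?P = (\<Sum>p\<in>?P \<inter> {p. real p \<le> z}. ln (real p) / sqrt (real p))"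
      by (simp add: sum.inter_restrict)
    also have "\<dots> \<le> (\<Sum>p | prime p \<and> real p \<le> z. ln (real p) / sqrt (real p))"
    proof (rule sum_mono2)
      show "finite {p. prime p \<and> real p \<le> z}"
        by (rule finite_subset[of _ "{..nat \<lfloor>z\<rfloor>}"]) (auto simp: le_nat_floor)
    qed (auto simp: prime_factors_dvd Suc_le_eq dest: prime_gt_0_nat)
    also have "\<dots> \<le> 6 * sqrt z" using assms by (intro sum_ln_primes_div_sqrt_le) auto
    finally show ?thesis .
  qed
  have "(\<Sum>p\<in>?P. real p powr (-\<sigma>)) \<le>
      (\<Sum>p\<in>?P. z powr (1/2 - \<sigma>) * (?f p + ?g p / ln w) + z powr (-\<sigma>) * (ln (real p) / ln z))"
    by (rule sum_mono) (rule pt)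
  also have "\<dots> = z powr (1/2 - \<sigma>) * (sum ?f ?P + sum ?g ?P / ln w) + z powr (-\<sigma>) * ((\<Sum>p\<in>?P. ln (real p)) / ln z)"
    by (simp only: sum.distrib sum_distrib_left[symmetric] sum_divide_distrib[symmetric])
  also have "\<dots> \<le> z powr (1/2 - \<sigma>) * (2 * sqrt w + 6 * sqrt z / ln w) + z powr (-\<sigma>) * (ln (real m) / ln z)"
    using f g lnw sum_ln_prime_factors_le[OF assms(1)]
    by (intro add_mono mult_left_mono divide_right_mono) auto
  finally show ?thesis .
qed

text \<open>Here l stands for ln N, the cutoff exp (l + l / (8 ln l)) bounds b N, and m ranges up to
  the frequency cutoff T. Compared with sqrt N, Rankin's bound saves 31/16 * l / ln l through the
  exponent \<sigma> and spends at most l / ln l on the sum over primes.\<close>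

lemma card_divisors_eventually_le:
  "eventually (\<lambda>l::real. \<forall>m::nat. m > 0 \<longrightarrow> ln (real m) \<le> (l / 6000)\<^sup>2 \<longrightarrow>
     real (card {d. d dvd m \<and> real d \<le> exp (l + l / (8 * ln l))}) \<le> exp (l / 2 - 15/16 * (l / ln l))) at_top"
proof -
  have "eventually (\<lambda>l::real. 8 \<le> ln l) at_top" by real_asymp
  moreover have "eventually (\<lambda>l::real. l \<le> (l / 6000)\<^sup>2) at_top" by real_asymp
  moreover have "eventually (\<lambda>l::real. 14 * 81 * sqrt l \<le> 1/3 * (l / ln l)) at_top" by real_asymp
  moreover have "eventually (\<lambda>l::real. 1 < l) at_top" by real_asymp
  ultimately show ?thesis
  proof eventually_elim
    case (elim l)
    \<comment> \<open>The cut z is the largest admissible ln m. The shift 2 / L is small enough to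
      keep z powr (2 / L) <= exp 4 bounded, yet it saves about 2 l / L in the main term. The
      condition L >= 8 gives \<sigma> >= 1/4.\<close>
    define L z \<sigma> where "L = ln l" and "z = (l / 6000)\<^sup>2" and "\<sigma> = 1/2 - 2 / L"
    have L: "L \<ge> 8" and l: "l > 1" using elim by (auto simp: L_def)
    have \<sigma>: "1/4 \<le> \<sigma>" "\<sigma> \<le> 1/2" using L by (auto simp: \<sigma>_def field_simps)
    have z: "l \<le> z" "1 < z" "sqrt z = l / 6000" using elim by (auto simp: z_def)
    have e4: "exp 4 \<le> (81::real)"
    proof -
      have "exp (4::real) = exp 1 ^ 4" by (simp flip: exp_of_nat_mult)
      also have "\<dots> \<le> 3 ^ 4" by (intro power_mono exp_le) auto
      finally show ?thesis by simp
    qed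
    have zpow: "z powr (1/2 - \<sigma>) \<le> exp 4"
    proof -
      have "z powr (1/2 - \<sigma>) \<le> (l\<^sup>2) powr (2 / L)"
        using L l by (auto intro!: powr_mono2 simp: \<sigma>_def z_def power_divide field_simps)
      also have "\<dots> = exp 4" using l L by (simp add: powr_def ln_realpow L_def)
      finally show ?thesis .
    qed
    have zneg: "z powr (-\<sigma>) \<le> exp 4 * (6000 / l)"
    proof -
      have "z powr (-\<sigma>) = z powr (1/2 - \<sigma>) * z powr (-(1/2))" by (simp flip: powr_add)
      also have "z powr (-(1/2)) = 6000 / l"
      proof -
        have "z powr (-(1/2)) = inverse (sqrt z)" using z(2) by (simp add: powr_minus powr_half_sqrt)
        then show ?thesis unfolding z(3) by simp
      qed
      also have "z powr (1/2 - \<sigma>) * (6000 / l) \<le> exp 4 * (6000 / l)"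
        using zpow l by (intro mult_right_mono) auto
      finally show ?thesis .
    qed
    show ?case
    proof (intro allI impI)
      fix m :: nat assume m: "m > 0" "ln (real m) \<le> (l / 6000)\<^sup>2"
      let ?S = "\<Sum>p\<in>prime_factors m. real p powr (-\<sigma>)"
      have "ln l \<le> ln z" using l z by simp
      have lnq: "ln (real m) / ln z \<le> (l / 6000)\<^sup>2 / L"
        using m L \<open>ln l \<le> ln z\<close> by (intro frac_le) (auto simp: L_def)
      have "?S \<le> z powr (1/2 - \<sigma>) * (2 * sqrt l + 6 * sqrt z / ln l) + z powr (-\<sigma>) * (ln (real m) / ln z)"
        using m \<sigma> l z by (intro sum_prime_factors_powr_le) auto
      also have "\<dots> \<le> exp 4 * (2 * sqrt l + 6 * (l / 6000) / L) + (exp 4 * (6000 / l)) * ((l / 6000)\<^sup>2 / L)"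
        using zpow zneg lnq z L l m by (intro add_mono mult_mono) (auto simp: L_def)
      also have "\<dots> = exp 4 * (2 * sqrt l + 7 / 6000 * (l / L))"
        using l L by (simp add: field_simps power2_eq_square)
      also have "\<dots> \<le> 81 * (2 * sqrt l + 7 / 6000 * (l / L))"
        using e4 l L by (intro mult_right_mono) auto
      \<comment> \<open>This fixes 6000: 7 * 81 * 7 / 6000 <= 2/3, and the remaining third of l / L
        absorbs the sqrt l term.\<close>
      finally have "7 * ?S \<le> 14 * 81 * sqrt l + 7 * 81 * 7 / 6000 * (l / L)" by (simp add: algebra_simps)
      moreover have "l / L \<ge> 0" using l L by simp
      ultimately have S: "7 * ?S \<le> l / L" using elim(3) by (simp add: L_def)
      have "\<sigma> * (l + l / (8 * L)) = l / 2 - 31/16 * (l / L) - l / (4 * L\<^sup>2)"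
        using L by (simp add: \<sigma>_def field_simps power2_eq_square)
      moreover have "l / (4 * L\<^sup>2) \<ge> 0" using l by simp
      ultimately have e: "\<sigma> * (l + l / (8 * L)) + 7 * ?S \<le> l / 2 - 15/16 * (l / L)" using S by linarith
      have "real (card {d. d dvd m \<and> real d \<le> exp (l + l / (8 * L))}) \<le> exp (l + l / (8 * L)) powr \<sigma> * exp (7 * ?S)"
        using m \<sigma> by (intro card_divisors_le) auto
      also have "\<dots> = exp (\<sigma> * (l + l / (8 * L)) + 7 * ?S)" by (simp add: powr_def flip: exp_add)
      also have "\<dots> \<le> exp (l / 2 - 15/16 * (l / L))" using e by simp
      finally show "real (card {d. d dvd m \<and> real d \<le> exp (l + l / (8 * ln l))}) \<le> exp (l / 2 - 15/16 * (l / ln l))"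
        by (simp add: L_def)
    qed
  qed
qed

section \<open>Decay of the cosine product at large t\<close>

lemma abs_prod_cos_le_subset:
  fixes f :: "'a \<Rightarrow> real"
  assumes "finite B" "A \<subseteq> B"
  shows "\<bar>\<Prod>n\<in>B. cos (f n)\<bar> \<le> \<bar>\<Prod>n\<in>A. cos (f n)\<bar>"
proof -
  have "(\<Prod>n\<in>B. cos (f n)) = (\<Prod>n\<in>B - A. cos (f n)) * (\<Prod>n\<in>A. cos (f n))"
    using assms by (rule prod.subset_diff[rotated])
  moreover have "\<bar>\<Prod>n\<in>B - A. cos (f n)\<bar> \<le> 1"
    unfolding abs_prod by (intro prod_le_1) auto
  ultimately show ?thesis by (simp add: abs_mult mult_left_le_one_le)
qed

lemma abs_prod_cos_le_exp_card:
  fixes f :: "'a \<Rightarrow> real"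
  assumes "finite A" "\<And>n. n \<in> A \<Longrightarrow> \<bar>cos (f n)\<bar> \<le> exp (-e)" "K \<le> real (card A)" "0 \<le> e"
  shows "\<bar>\<Prod>n\<in>A. cos (f n)\<bar> \<le> exp (- K * e)"
proof -
  have "\<bar>\<Prod>n\<in>A. cos (f n)\<bar> \<le> (\<Prod>n\<in>A. exp (-e))"
    unfolding abs_prod using assms by (intro prod_mono) auto
  also have "\<dots> = exp (- (real (card A) * e))" by (simp flip: exp_of_nat_mult)
  also have "\<dots> \<le> exp (- K * e)" using assms by (simp add: mult_right_mono)
  finally show ?thesis .
qed

text \<open>If \<open>t / c n\<close> is close to a multiple of \<open>\<pi>\<close>, then \<open>c n\<close> divides an integer
  within distance \<open>r\<close> of \<open>t / \<pi>\<close>; the divisor bound \<open>D\<close> limits how often this happens.\<close>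

lemma abs_prod_cos_le_of_divisor_bound:
  fixes c :: "'a \<Rightarrow> nat" and t r X D K :: real
  assumes fin: "finite A" and inj: "inj_on c A" and c: "\<And>n. n \<in> A \<Longrightarrow> 0 < c n \<and> real (c n) \<le> X"
    and r: "1 \<le> r" "r < t / pi" and X: "X > 0"
    and D: "\<And>m. 0 < m \<Longrightarrow> real m \<le> t / pi + r \<Longrightarrow> real (card {d. d dvd m \<and> real d \<le> X}) \<le> D"
    and K: "K + 3 * r * D \<le> real (card A)"
  shows "\<bar>\<Prod>n\<in>A. cos (t / real (c n))\<bar> \<le> exp (- K * ((r / X)\<^sup>2 / 8))"
proof -
  define y where "y = t / pi"
  define Bad where "Bad = {n \<in> A. \<exists>k::int. \<bar>y - of_int k * real (c n)\<bar> < r}"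
  \<comment> \<open>The integers within r of y; there are at most 2 r + 1 <= 3 r of them.\<close>
  define I where "I = {nat \<lceil>y - r\<rceil>..nat \<lfloor>y + r\<rfloor>}"
  have yr: "y - r > 0" using r by (simp add: y_def)
  have I_iff: "m \<in> I \<longleftrightarrow> y - r \<le> real m \<and> real m \<le> y + r" for m
    unfolding I_def using yr r by (auto simp: ceiling_le_iff le_floor_iff nat_le_iff le_nat_iff)
  have I_pos: "0 < m" if "m \<in> I" for m using that yr by (auto simp: I_iff intro!: Nat.gr0I)
  have "real (card I) \<le> 2 * r + 1"
  proof -
    have "real (nat \<lfloor>y + r\<rfloor>) \<le> y + r" "real (nat \<lceil>y - r\<rceil>) \<ge> y - r" using yr r by linarith+
    then show ?thesis using r by (cases "nat \<lceil>y - r\<rceil> \<le> Suc (nat \<lfloor>y + r\<rfloor>)") (auto simp: I_def of_nat_diff)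
  qed
  then have cardI: "real (card I) \<le> 3 * r" using r by simp
  \<comment> \<open>The hypothesis on \<open>D\<close> is applied to one actual member of
    \<open>I\<close>; the sign of \<open>D\<close> is needed to multiply the bound on
    \<open>card I\<close> by it.\<close>
  have D0: "D \<ge> 0"
  proof -
    have "real (nat \<lceil>y - r\<rceil>) < y - r + 1" using yr by linarith
    then have "nat \<lceil>y - r\<rceil> \<in> I" using r yr by (auto simp: I_iff)
    then have "real (card {d. d dvd nat \<lceil>y - r\<rceil> \<and> real d \<le> X}) \<le> D"
      using I_pos I_iff unfolding y_def by (intro D) blast+
    then show ?thesis by (rule order_trans[OF of_nat_0_le_iff])
  qed
  have "c ` Bad \<subseteq> (\<Union>m\<in>I. {d. d dvd m \<and> real d \<le> X})"
  proof clarify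
    fix n assume "n \<in> Bad"
    then obtain k where n: "n \<in> A" and k: "\<bar>y - of_int k * real (c n)\<bar> < r" by (auto simp: Bad_def)
    \<comment> \<open>The multiple must be positive, since 0 is divisible by everything and would
      defeat the divisor count; this is where r < t / pi enters.\<close>
    have "of_int k * real (c n) > 0" using k yr by linarith
    then have "k > 0" using c[OF n] by (simp add: zero_less_mult_iff)
    then have "of_int k * real (c n) = real (nat k * c n)" by simp
    then have "nat k * c n \<in> I" using k unfolding I_iff by linarith
    then show "c n \<in> (\<Union>m\<in>I. {d. d dvd m \<and> real d \<le> X})" using c[OF n] by (intro UN_I) auto
  qed
  moreover have "finite (\<Union>m\<in>I. {d. d dvd m \<and> real d \<le> X})"
    using I_pos by (auto simp: I_def)
  ultimately have "card (c ` Bad) \<le> card (\<Union>m\<in>I. {d. d dvd m \<and> real d \<le> X})" by (intro card_mono)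
  also have "\<dots> \<le> (\<Sum>m\<in>I. card {d. d dvd m \<and> real d \<le> X})" by (rule card_UN_le) (simp add: I_def)
  finally have "real (card (c ` Bad)) \<le> (\<Sum>m\<in>I. real (card {d. d dvd m \<and> real d \<le> X}))"
    by (simp flip: of_nat_sum)
  also have "\<dots> \<le> (\<Sum>m\<in>I. D)" using I_pos by (intro sum_mono D) (auto simp: I_iff y_def)
  also have "\<dots> = real (card I) * D" by simp
  also have "\<dots> \<le> 3 * r * D" using cardI D0 by (intro mult_right_mono)
  also have "card (c ` Bad) = card Bad"
    by (intro card_image inj_on_subset[OF inj]) (auto simp: Bad_def)
  finally have Bad: "real (card Bad) \<le> 3 * r * D" .
  have "card (A - Bad) + card Bad = card A"
    using fin by (subst card_Un_disjoint[symmetric]) (auto simp: Bad_def intro!: arg_cong[of _ _ card])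
  then have cardK: "K \<le> real (card (A - Bad))" using Bad K by linarith
  have "\<bar>\<Prod>n\<in>A. cos (t / real (c n))\<bar> \<le> \<bar>\<Prod>n\<in>A - Bad. cos (t / real (c n))\<bar>"
    using fin by (intro abs_prod_cos_le_subset) auto
  also have "\<dots> \<le> exp (- K * ((r / X)\<^sup>2 / 8))"
  proof (rule abs_prod_cos_le_exp_card)
    fix n assume n: "n \<in> A - Bad"
    have cn: "real (c n) > 0" "real (c n) \<le> X" using c n by auto
    \<comment> \<open>For n outside \<open>Bad\<close>, t / c n is at distance pi * |y - k * c n| /
      c n >= r / c n >= r / X from each k * pi.\<close>
    have "\<bar>cos (t / real (c n))\<bar> \<le> exp (- (r / X)\<^sup>2 / 8)"
    proof (rule abs_cos_le_exp_dist)
      fix k :: int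
      have "r \<le> \<bar>y - of_int k * real (c n)\<bar>" using n by (auto simp: Bad_def not_less)
      also have "\<dots> \<le> pi * \<bar>y - of_int k * real (c n)\<bar>"
        using pi_gt3 by (simp add: mult_le_cancel_right1)
      finally have "r / real (c n) \<le> pi * \<bar>y - of_int k * real (c n)\<bar> / real (c n)"
        using cn by (intro divide_right_mono) auto
      also have "\<dots> = \<bar>pi * (y - of_int k * real (c n)) / real (c n)\<bar>"
        using cn by (simp add: abs_mult)
      also have "pi * (y - of_int k * real (c n)) / real (c n) = t / real (c n) - of_int k * pi"
        using cn by (simp add: y_def field_simps)
      finally show "r / X \<le> \<bar>t / real (c n) - of_int k * pi\<bar>"
        using cn r divide_left_mono[of "real (c n)" X r] by (simp add: X)
    qed (use r X in auto)
    then show "\<bar>cos (t / real (c n))\<bar> \<le> exp (- ((r / X)\<^sup>2 / 8))" by simp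
  qed (use fin cardK in auto)
  finally show ?thesis .
qed

text \<open>The upper half of the indices suffices: at most N/4 of its at least N/2 members are bad,
  and the others make the product at most exp (- exp (3/4 * q) / 64) with q = ln N / ln ln N. Since
  exp (3/4 * q) outgrows (ln N)^2, this beats 1/t^2 up to the cutoff.\<close>

lemma abs_prod_cos_eventually_le:
  fixes b :: "nat \<Rightarrow> nat"
  assumes mono: "strict_mono_on {1..} b" and pos: "\<And>n. n \<ge> 1 \<Longrightarrow> b n > 0"
    and ub: "\<forall>\<^sub>F n in sequentially. real (b n) \<le> exp (ln (real n) + ln (real n) / (8 * ln (ln (real n))))"
  shows "\<forall>\<^sub>F N in sequentially. \<forall>t. real N / 2 \<le> t \<longrightarrow> t \<le> exp ((ln (real N) / 6000)\<^sup>2) \<longrightarrow>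
           \<bar>\<Prod>n\<in>{N div 2<..N}. cos (t / real (b n))\<bar> \<le> 1 / t\<^sup>2"
proof -
  have lim: "filterlim (\<lambda>N::nat. ln (real N)) at_top sequentially" by real_asymp
  have "eventually (\<lambda>l::real. 8 \<le> ln l) at_top" by real_asymp
  moreover have "eventually (\<lambda>l::real. 3 * exp (l - 7/16 * (l / ln l)) \<le> exp l / 4) at_top" by real_asymp
  moreover have "eventually (\<lambda>l::real. exp (l / 2 + l / ln l / 2) < exp l / 8) at_top" by real_asymp
  moreover have "eventually (\<lambda>l::real. 2 * (l / 6000)\<^sup>2 \<le> exp (3/4 * (l / ln l)) / 64) at_top" by real_asymp
  moreover note card_divisors_eventually_le
  ultimately have ev: "eventually (\<lambda>l::real. 8 \<le> ln l \<and> 3 * exp (l - 7/16 * (l / ln l)) \<le> exp l / 4 \<and>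
      exp (l / 2 + l / ln l / 2) < exp l / 8 \<and> 2 * (l / 6000)\<^sup>2 \<le> exp (3/4 * (l / ln l)) / 64 \<and>
      (\<forall>m::nat. m > 0 \<longrightarrow> ln (real m) \<le> (l / 6000)\<^sup>2 \<longrightarrow>
         real (card {d. d dvd m \<and> real d \<le> exp (l + l / (8 * ln l))}) \<le> exp (l / 2 - 15/16 * (l / ln l)))) at_top"
    by eventually_elim blast
  have "eventually (\<lambda>N::nat. N \<ge> 2) sequentially" by (rule eventually_ge_at_top)
  with eventually_compose_filterlim[OF ev lim] ub show ?thesis
  proof eventually_elim
    case (elim N)
    define l L q where "l = ln (real N)" and "L = ln l" and "q = l / L"
    \<comment> \<open>The window is r = exp (l/2 + c * q) with c = 1/2. Few bad indices, r * D =
      o(N), requires c < 15/16, and growth of N * (r / X)^2 = exp ((2 c - 1/4) * q) requires c >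
      1/8.\<close>
    define X r D where "X = exp (l + q / 8)" and "r = exp (l / 2 + q / 2)" and "D = exp (l / 2 - 15/16 * q)"
    have X_eq: "X = exp (l + l / (8 * ln l))" by (simp add: X_def q_def L_def)
    have N: "N \<ge> 2" "exp l = real N" using elim by (auto simp: l_def)
    have "L \<ge> 8" "l \<ge> 0" using elim N by (auto simp: L_def l_def)
    then have q: "q \<ge> 0" by (simp add: q_def)
    have small: "3 * exp (l - 7/16 * q) \<le> exp l / 4" "r < exp l / 8" "2 * (l / 6000)\<^sup>2 \<le> exp (3/4 * q) / 64"
      using elim(1) by (auto simp: r_def q_def L_def l_def)
    have r1: "1 \<le> r" using q \<open>l \<ge> 0\<close> by (simp add: r_def)
    have bX: "0 < b n \<and> real (b n) \<le> X" if "n \<in> {N div 2<..N}" for n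
    proof -
      have "b n \<le> b N" using that strict_mono_on_leD[OF mono, of n N] by auto
      moreover have "real (b N) \<le> X" using elim(2) by (simp add: X_eq l_def)
      ultimately show ?thesis using pos[of n] that by auto
    qed
    show ?case
    proof (intro allI impI)
      fix t :: real assume t: "real N / 2 \<le> t" "t \<le> exp ((ln (real N) / 6000)\<^sup>2)"
      have t0: "t > 0" using t N by linarith
      have lnt: "ln t \<le> (l / 6000)\<^sup>2"
      proof -
        have "ln t \<le> ln (exp ((l / 6000)\<^sup>2))" using t t0 unfolding l_def by (subst ln_le_cancel_iff) auto
        then show ?thesis by simp
      qed
      have "real N / 8 \<le> t / pi"
      proof -
        have "t * pi \<le> t * 4" using pi_less_4 t0 by (intro mult_left_mono) auto
        then have "t / 4 \<le> t / pi" using t0 by (simp add: field_simps)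
        then show ?thesis using t by linarith
      qed
      then have rt: "r < t / pi" using small N by linarith
      \<comment> \<open>Every integer m in the window is then at most t, so the divisor bound
        applies to it.\<close>
      have tt: "t / pi + r \<le> t"
      proof -
        have "t / pi \<le> t / 2" using pi_gt3 t0 by (intro divide_left_mono) auto
        then show ?thesis using rt by linarith
      qed
      have "\<bar>\<Prod>n\<in>{N div 2<..N}. cos (t / real (b n))\<bar> \<le> exp (- (real N / 8) * ((r / X)\<^sup>2 / 8))"
      proof (rule abs_prod_cos_le_of_divisor_bound)
        show "inj_on b {N div 2<..N}"
          using strict_mono_on_imp_inj_on[OF mono] by (rule inj_on_subset) auto
        show "real (card {d. d dvd m \<and> real d \<le> X}) \<le> D" if "0 < m" "real m \<le> t / pi + r" for m
        proof -
          have "ln (real m) \<le> ln t" using that tt t0 by simp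
          also note lnt
          finally show ?thesis using elim(1) that by (simp add: D_def X_eq q_def L_def l_def)
        qed
        have "3 * r * D = 3 * exp (l - 7/16 * q)" by (simp add: r_def D_def flip: exp_add)
        then show "real N / 8 + 3 * r * D \<le> real (card {N div 2<..N})" using small N by simp
      qed (use bX r1 rt in \<open>auto simp: X_def\<close>)
      also have "- (real N / 8) * ((r / X)\<^sup>2 / 8) = - (exp (3/4 * q) / 64)"
      proof -
        have "r / X = exp (3/8 * q - l / 2)" by (simp add: r_def X_def flip: exp_diff)
        then have "(r / X)\<^sup>2 = exp (3/4 * q - l)" by (simp flip: exp_double)
        then show ?thesis using N by (simp add: exp_diff)
      qed
      also have "exp (- (exp (3/4 * q) / 64)) \<le> exp (- (2 * ln t))"
        using small lnt by simp
      also have "\<dots> = 1 / t\<^sup>2" using t0 by (simp add: exp_minus exp_double inverse_eq_divide)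
      finally show "\<bar>\<Prod>n\<in>{N div 2<..N}. cos (t / real (b n))\<bar> \<le> 1 / t\<^sup>2" .
    qed
  qed
qed

section \<open>The cosine product at small t\<close>

lemma prod_cos_ge:
  fixes b :: "nat \<Rightarrow> nat" and t :: real
  assumes b: "\<And>n. n > M \<Longrightarrow> n \<le> b n" and M: "0 < M" "M \<le> N" and t: "0 \<le> t" "t \<le> 1"
  shows "1 - (1 / real M - 1 / real N) \<le> (\<Prod>n\<in>{M<..N}. cos (t / real (b n)))"
  using M(2)
proof (induction N rule: dec_induct)
  case (step k)
  let ?c = "cos (t / real (b (Suc k)))"
  let ?P = "\<Prod>n\<in>{M<..k}. cos (t / real (b n))"
  have bN: "real (b (Suc k)) \<ge> real k + 1" using b[of "Suc k"] step by linarith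
  define x where "x = t / real (b (Suc k))"
  have x: "0 \<le> x" "x \<le> 1 / (real k + 1)"
    using t bN by (auto simp: x_def intro!: frac_le)
  have "(sin (x / 2))\<^sup>2 \<le> (x / 2)\<^sup>2"
    using abs_sin_x_le_abs_x[of "x / 2"] unfolding abs_le_square_iff .
  moreover have "cos x = 1 - 2 * (sin (x / 2))\<^sup>2" using cos_double_sin[of "x / 2"] by simp
  ultimately have "1 - x\<^sup>2 / 2 \<le> cos x" by (simp add: power_divide)
  moreover have "x\<^sup>2 \<le> (1 / (real k + 1))\<^sup>2" using x by (intro power_mono)
  \<comment> \<open>The quadratic loss of each cosine is dominated by a telescoping difference, and
    (1 - p) * (1 - q) >= 1 - (p + q) carries the total loss through the induction.\<close>
  moreover have "(1 / (real k + 1))\<^sup>2 \<le> 1 / real k - 1 / (real k + 1)"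
  proof -
    have "(1 / (real k + 1))\<^sup>2 = 1 / ((real k + 1) * (real k + 1))" by (simp add: power2_eq_square)
    also have "\<dots> \<le> 1 / (real k * (real k + 1))"
      using step M by (intro divide_left_mono mult_right_mono) auto
    also have "\<dots> = 1 / real k - 1 / (real k + 1)" using step M by (simp add: field_simps)
    finally show ?thesis .
  qed
  ultimately have "1 - (1 / real k - 1 / (real k + 1)) \<le> cos x"
    using zero_le_power2[of x] by linarith
  then have c: "1 - (1 / real k - 1 / real (Suc k)) \<le> ?c"
    by (simp add: x_def add.commute)
  have u: "0 \<le> 1 / real M - 1 / real k" "1 / real M \<le> 1" "0 \<le> 1 / real k - 1 / real (Suc k)"
    "1 / real k \<le> 1" "0 \<le> 1 / real k" "0 \<le> 1 / real (Suc k)"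
    using step M by (auto simp: field_simps)
  have "1 - (1 / real M - 1 / real (Suc k)) \<le>
      (1 - (1 / real M - 1 / real k)) * (1 - (1 / real k - 1 / real (Suc k)))"
  proof -
    have "1 - (p + q) \<le> (1 - p) * (1 - q)" if "0 \<le> p" "0 \<le> q" for p q :: real
      using mult_nonneg_nonneg[OF that] by (simp add: algebra_simps)
    from this[OF u(1,3)] show ?thesis by simp
  qed
  also have "\<dots> \<le> ?P * ?c"
  proof (rule mult_mono)
    show ge: "1 - (1 / real M - 1 / real k) \<le> ?P" by (rule step.IH)
    show "0 \<le> ?P" using ge u by linarith
    show "0 \<le> 1 - (1 / real k - 1 / real (Suc k))" using u by linarith
  qed (rule c)
  also have "?P * ?c = (\<Prod>n\<in>{M<..Suc k}. cos (t / real (b n)))"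
  proof -
    have "{M<..Suc k} = insert (Suc k) {M<..k}" using step by auto
    then show ?thesis by simp
  qed
  finally show ?case .
qed simp

text \<open>For n in (t, 2t] the argument t / b n lies in [t / (2t) powr (9/8), 1], so it cannot
  wrap around to a nonzero multiple of pi. At least t/2 factors, each with exponent of order t powr
  (-1/4), give total exponent of order t powr (3/4), independently of N.\<close>

lemma abs_prod_cos_le_small:
  fixes b :: "nat \<Rightarrow> nat" and t :: real
  assumes b: "\<And>n. n > M \<Longrightarrow> n \<le> b n \<and> real (b n) \<le> real n powr (9/8)"
    and t: "2 \<le> t" "real M \<le> t" "2 * t \<le> real N"
  shows "\<bar>\<Prod>n\<in>{M<..N}. cos (t / real (b n))\<bar> \<le> exp (- ((2 * t) powr (3/4) / 128))"
proof -
  define A where "A = {nat \<lfloor>t\<rfloor><..nat \<lfloor>2 * t\<rfloor>}"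
  have A: "t < real n" "real n \<le> 2 * t" if "n \<in> A" for n
    using that t unfolding A_def by (auto, linarith+)
  have sub: "A \<subseteq> {M<..N}"
  proof
    fix n assume "n \<in> A"
    then show "n \<in> {M<..N}" using A[of n] t by auto
  qed
  \<comment> \<open>The cardinality exceeds t - 1, and t - 1 >= t/2 because t >= 2.\<close>
  have card: "t / 2 \<le> real (card A)"
    using t by (simp add: A_def) linarith
  define e where "e = (t / (2 * t) powr (9/8))\<^sup>2 / 8"
  have "\<bar>\<Prod>n\<in>{M<..N}. cos (t / real (b n))\<bar> \<le> \<bar>\<Prod>n\<in>A. cos (t / real (b n))\<bar>"
    using sub by (intro abs_prod_cos_le_subset) auto
  also have "\<dots> \<le> exp (- (t / 2) * e)"
  proof (rule abs_prod_cos_le_exp_card)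
    fix n assume n: "n \<in> A"
    have "n > M" using sub n by auto
    have bn: "t < real (b n)" "real (b n) \<le> (2 * t) powr (9/8)"
    proof -
      show "t < real (b n)" using b[OF \<open>n > M\<close>] A[OF n] by linarith
      have "real n powr (9/8) \<le> (2 * t) powr (9/8)" using A[OF n] by (intro powr_mono2) auto
      then show "real (b n) \<le> (2 * t) powr (9/8)" using b[OF \<open>n > M\<close>] by linarith
    qed
    define x where "x = t / real (b n)"
    have x: "0 \<le> x" "x \<le> 1" using bn t by (auto simp: x_def)
    have "t / (2 * t) powr (9/8) \<le> x" unfolding x_def using bn t by (intro divide_left_mono) auto
    moreover have "x / 2 \<le> \<bar>sin x\<bar>" using abs_sin_ge_half[of x] x pi_gt3 by simp
    ultimately have "(t / (2 * t) powr (9/8) / 2)\<^sup>2 \<le> \<bar>sin x\<bar>\<^sup>2" using t by (intro power_mono) auto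
    then have "e \<le> (sin x)\<^sup>2 / 2" by (simp add: e_def power_divide)
    moreover have "\<bar>cos x\<bar> \<le> exp (- (sin x)\<^sup>2 / 2)" by (rule abs_cos_le_exp)
    ultimately show "\<bar>cos (t / real (b n))\<bar> \<le> exp (- e)"
      unfolding x_def[symmetric] by (smt (verit) exp_le_cancel_iff minus_divide_left)
  qed (use card in \<open>auto simp: A_def e_def\<close>)
  also have "(t / 2) * e = (2 * t) powr (3/4) / 128"
  proof -
    have "((2 * t) powr (9/8))\<^sup>2 = (2 * t) powr (9/4)" using t by (simp add: powr_powr flip: powr_numeral)
    then have "(t / 2) * e = t ^ 3 / (16 * (2 * t) powr (9/4))"
      by (simp add: e_def power_divide power2_eq_square power3_eq_cube)
    also have "t ^ 3 = (2 * t) powr 3 / 8" using t by (simp add: powr_numeral power_mult_distrib)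
    also have "\<dots> = (2 * t) powr (3/4) * (2 * t) powr (9/4) / 8" by (simp flip: powr_add)
    finally show ?thesis using t by simp
  qed
  then have "- (t / 2) * e = - ((2 * t) powr (3/4) / 128)" by simp
  finally show ?thesis .
qed

section \<open>Fejer kernel, choice of signs and lower bound for the integral\<close>

lemma integral_fejer:
  fixes y T :: real
  assumes "y \<noteq> 0" "T > 0"
  shows "integral {0..T} (\<lambda>t. (1 - t / T) * cos (t * y)) = (1 - cos (T * y)) / (T * y\<^sup>2)"
proof -
  \<comment> \<open>Antiderivative from one integration by parts. The triangular weight brings the
    transform down to at most 2 / (T y^2); a sharp cutoff would leave sin (T y) / y, too large for a
    contradiction later.\<close>
  define F where "F = (\<lambda>t. (1 - t / T) * sin (t * y) / y - cos (t * y) / (T * y\<^sup>2))"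
  have "((\<lambda>t. (1 - t / T) * cos (t * y)) has_integral (F T - F 0)) {0..T}"
  proof (rule fundamental_theorem_of_calculus)
    show "(F has_vector_derivative (1 - t / T) * cos (t * y)) (at t within {0..T})" for t
      unfolding F_def has_real_derivative_iff_has_vector_derivative[symmetric] using assms
      by (auto intro!: derivative_eq_intros simp: field_simps power2_eq_square)
  qed (use assms in simp)
  then show ?thesis using assms by (simp add: integral_unique F_def diff_divide_distrib)
qed

text \<open>Since \<open>(cos (t (x - a)) + cos (t (x + a))) / 2 = cos (t a) cos (t x)\<close>, at least one choice
  of each sign does not decrease the integral.\<close>

lemma exists_signs_integral_ge:
  fixes w :: "real \<Rightarrow> real" and a :: "nat \<Rightarrow> real"
  assumes "finite I" "continuous_on {0..T} w"
  shows "\<exists>s. (\<forall>n. s n \<in> {-1, 1}) \<and>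
    integral {0..T} (\<lambda>t. w t * (\<Prod>n\<in>I. cos (t * a n)) * cos (t * x))
      \<le> integral {0..T} (\<lambda>t. w t * cos (t * (x - (\<Sum>n\<in>I. s n * a n))))"
  using assms(1)
proof (induction I arbitrary: x rule: finite_induct)
  case empty
  show ?case by (auto intro!: exI[of _ "\<lambda>_. 1"])
next
  case (insert k I)
  let ?g = "\<lambda>x t. w t * (\<Prod>n\<in>I. cos (t * a n)) * cos (t * x)"
  have int: "?g x integrable_on {0..T}" for x
    by (intro integrable_continuous_interval continuous_intros assms)
  have "integral {0..T} (\<lambda>t. w t * (\<Prod>n\<in>insert k I. cos (t * a n)) * cos (t * x)) =
      integral {0..T} (\<lambda>t. (?g (x - a k) t + ?g (x + a k) t) / 2)"
    using insert.hyps
    by (intro arg_cong[of _ _ "integral {0..T}"] ext)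
      (simp add: right_diff_distrib distrib_left cos_diff cos_add algebra_simps)
  also have "\<dots> = (integral {0..T} (?g (x - a k)) + integral {0..T} (?g (x + a k))) / 2"
    by (simp add: integral_add[OF int int])
  finally have avg: "integral {0..T} (\<lambda>t. w t * (\<Prod>n\<in>insert k I. cos (t * a n)) * cos (t * x)) =
    (integral {0..T} (?g (x - a k)) + integral {0..T} (?g (x + a k))) / 2" .
  obtain e :: real where e: "e \<in> {-1, 1}" and
    le: "integral {0..T} (\<lambda>t. w t * (\<Prod>n\<in>insert k I. cos (t * a n)) * cos (t * x))
      \<le> integral {0..T} (?g (x - e * a k))"
  proof (cases "integral {0..T} (?g (x + a k)) \<le> integral {0..T} (?g (x - a k))")
    case True
    then show ?thesis using that[of 1] avg by simp
  next
    case False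
    then show ?thesis using that[of "-1"] avg by simp
  qed
  obtain s where s: "\<forall>n. s n \<in> {-1, 1}" and
    le': "integral {0..T} (?g (x - e * a k)) \<le>
      integral {0..T} (\<lambda>t. w t * cos (t * (x - e * a k - (\<Sum>n\<in>I. s n * a n))))"
    using insert.IH[of "x - e * a k"] by blast
  have "(\<Sum>n\<in>insert k I. (s(k := e)) n * a n) = e * a k + (\<Sum>n\<in>I. s n * a n)"
    using insert.hyps by (auto intro!: sum.cong)
  moreover have "\<forall>n. (s(k := e)) n \<in> {-1, 1}" using s e by auto
  ultimately show ?case using le le' by (intro exI[of _ "s(k := e)"]) (simp add: algebra_simps)
qed

text \<open>Greedy choice: subtract the next term while the remainder is positive, otherwise add it.
  If the remainder exceeded the last term at every index from M0 on, no step would cross zero, so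
  each would shrink its modulus by the full term, contradicting divergence.\<close>

lemma exists_signs_remainder_le:
  fixes a :: "nat \<Rightarrow> real"
  assumes pos: "\<And>n. n \<ge> 1 \<Longrightarrow> 0 \<le> a n"
    and div: "filterlim (\<lambda>N. \<Sum>n=1..N. a n) at_top sequentially"
  shows "\<exists>M\<ge>M0. \<exists>s. (\<forall>n. s n \<in> {-1, 1::real}) \<and> \<bar>x - (\<Sum>n=1..M. s n * a n)\<bar> \<le> a M"
proof -
  define g :: "nat \<Rightarrow> real" where "g = rec_nat x (\<lambda>n y. if y > 0 then y - a (Suc n) else y + a (Suc n))"
  define s :: "nat \<Rightarrow> real" where "s n = (if g (n - 1) > 0 then 1 else -1)" for n
  have g0: "g 0 = x" and gSuc: "g (Suc n) = g n - s (Suc n) * a (Suc n)" for n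
    by (auto simp: g_def s_def)
  have g: "g N = x - (\<Sum>n=1..N. s n * a n)" for N
    by (induction N) (auto simp: g0 gSuc)
  have "\<exists>M\<ge>M0. \<bar>g M\<bar> \<le> a M"
  proof (rule ccontr)
    assume *: "\<not> ?thesis"
    define K where "K = Suc M0"
    have step: "\<bar>g (Suc n)\<bar> = \<bar>g n\<bar> - a (Suc n)" if "n \<ge> M0" for n
    proof -
      have "a (Suc n) < \<bar>g (Suc n)\<bar>" using * that by (meson le_SucI not_le)
      then show ?thesis using pos[of "Suc n"] by (auto simp: gSuc s_def abs_if split: if_splits)
    qed
    have sum: "(\<Sum>n=1..N. a n) + \<bar>g N\<bar> = (\<Sum>n=1..M0. a n) + \<bar>g M0\<bar>" if "N \<ge> M0" for N
      using that by (induction N rule: dec_induct) (auto simp: step)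
    have "eventually (\<lambda>N. (\<Sum>n=1..N. a n) > (\<Sum>n=1..M0. a n) + \<bar>g M0\<bar>) sequentially"
      using div by (auto simp: filterlim_at_top_dense)
    then have "eventually (\<lambda>N::nat. False) sequentially"
      using eventually_ge_at_top[of M0]
    proof eventually_elim
      case (elim N)
      then show ?case using sum[of N] by simp
    qed
    then show False by simp
  qed
  moreover have "\<forall>n. s n \<in> {-1, 1}" by (auto simp: s_def)
  ultimately show ?thesis unfolding g by blast
qed

text \<open>On [0, 1] each of the three factors is at least 1/2, which contributes 1/8. On [1, M]
  the integrand is nonnegative, because t / b n and |t x| are at most 1. On [M, T] the loss is at
  most the integral of 1/t^2, hence at most 1/M <= 1/16.\<close>

lemma integral_prod_cos_ge:
  fixes b :: "nat \<Rightarrow> nat" and T x :: real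
  assumes b: "\<And>n. n > M \<Longrightarrow> n \<le> b n" and M: "16 \<le> M" "M \<le> N" "real M \<le> T"
    and x: "\<bar>x\<bar> \<le> 1 / real M"
    and P: "\<And>t. real M \<le> t \<Longrightarrow> t \<le> T \<Longrightarrow> \<bar>\<Prod>n\<in>{M<..N}. cos (t / real (b n))\<bar> \<le> 1 / t\<^sup>2"
  shows "1 / 16 \<le> integral {0..T} (\<lambda>t. (1 - t / T) * (\<Prod>n\<in>{M<..N}. cos (t / real (b n))) * cos (t * x))"
proof -
  define P where "P t = (\<Prod>n\<in>{M<..N}. cos (t / real (b n)))" for t
  define h where "h t = (1 - t / T) * P t * cos (t * x)" for t
  have "continuous_on S h" for S
    unfolding h_def P_def
  proof (intro continuous_intros ballI)
    fix n assume "n \<in> {M<..N}"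
    then show "real (b n) \<noteq> 0" using b[of n] by auto
  qed (use M in auto)
  then have int: "h integrable_on {u..v}" for u v by (rule integrable_continuous_interval)
  have x_mult: "\<bar>t * x\<bar> \<le> 1" if "0 \<le> t" "t \<le> real M" for t
  proof -
    have "\<bar>t * x\<bar> \<le> real M * (1 / real M)" unfolding abs_mult using that x by (intro mult_mono) auto
    then show ?thesis using M by simp
  qed
  have cos_ge: "1 / 2 \<le> cos y" if "\<bar>y\<bar> \<le> 1" for y :: real
  proof -
    have "cos (pi / 3) \<le> cos \<bar>y\<bar>" using that pi_gt3 by (intro cos_monotone_0_pi_le) auto
    then show ?thesis by (simp add: cos_60)
  qed
  have P_pos: "0 \<le> P t" if "0 \<le> t" "t \<le> real M" for t
    unfolding P_def
  proof (rule prod_nonneg)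
    fix n assume "n \<in> {M<..N}"
    then have "t / real (b n) \<le> 1" using b[of n] that by (auto simp: divide_le_eq)
    then show "0 \<le> cos (t / real (b n))" using cos_ge[of "t / real (b n)"] that by simp
  qed
  have "1 / 8 \<le> integral {0..1} h"
  proof -
    have "integral {0..1::real} (\<lambda>_. 1 / 8 :: real) \<le> integral {0..1} h"
    proof (rule integral_le)
      fix t :: real assume t: "t \<in> {0..1}"
      have "1 / real M \<le> 1 / 2" using M by (simp add: field_simps)
      moreover have "0 \<le> 1 / real N" by simp
      moreover have "1 - (1 / real M - 1 / real N) \<le> P t"
        unfolding P_def using t M b by (intro prod_cos_ge) auto
      ultimately have "1 / 2 \<le> P t" by linarith
      moreover have "1 / 2 \<le> 1 - t / T" using t M by (simp add: field_simps)
      moreover have "1 / 2 \<le> cos (t * x)" using t M by (intro cos_ge x_mult) auto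
      ultimately have "1 / 2 * (1 / 2) * (1 / 2) \<le> h t" unfolding h_def by (intro mult_mono mult_nonneg_nonneg) linarith+
      then show "1 / 8 \<le> h t" by simp
    qed (auto intro: int)
    then show ?thesis by simp
  qed
  moreover have "0 \<le> integral {1..real M} h"
  proof (rule integral_nonneg)
    fix t assume t: "t \<in> {1..real M}"
    have "0 \<le> 1 - t / T" "0 \<le> P t" "0 \<le> cos (t * x)"
      using t M P_pos[of t] cos_ge[OF x_mult[of t]] by (auto simp: field_simps)
    then show "0 \<le> h t" by (simp add: h_def)
  qed (rule int)
  moreover have "- (1 / 16) \<le> integral {real M..T} h"
  proof -
    have "((\<lambda>t. - (1 / t\<^sup>2)) has_integral (1 / T - 1 / real M)) {real M..T}"
    proof (rule fundamental_theorem_of_calculus)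
      fix t assume "t \<in> {real M..T}"
      then show "((\<lambda>t. 1 / t) has_vector_derivative - (1 / t\<^sup>2)) (at t within {real M..T})"
        unfolding has_real_derivative_iff_has_vector_derivative[symmetric] using M
        by (auto intro!: derivative_eq_intros simp: power2_eq_square)
    qed (use M in auto)
    then have "1 / T - 1 / real M \<le> integral {real M..T} h"
    proof (rule has_integral_le[OF _ integrable_integral[OF int]])
      fix t assume t: "t \<in> {real M..T}"
      then have T: "\<bar>1 - t / T\<bar> \<le> 1" using M by (auto simp: field_simps abs_le_iff)
      have "\<bar>h t\<bar> = \<bar>1 - t / T\<bar> * \<bar>P t\<bar> * \<bar>cos (t * x)\<bar>" by (simp add: h_def abs_mult)
      also have "\<dots> \<le> 1 * (1 / t\<^sup>2) * 1"
        using assms(6)[of t] t T by (intro mult_mono) (auto simp: P_def)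
      finally show "- (1 / t\<^sup>2) \<le> h t" by simp
    qed
    moreover have "1 / real M \<le> 1 / 16" "0 \<le> 1 / T" using M by (auto simp: field_simps)
    ultimately show ?thesis by linarith
  qed
  moreover have "integral {0..1} h + integral {1..real M} h = integral {0..real M} h"
    using M by (intro Henstock_Kurzweil_Integration.integral_combine int) auto
  moreover have "integral {0..real M} h + integral {real M..T} h = integral {0..T} h"
    using M by (intro Henstock_Kurzweil_Integration.integral_combine int) auto
  ultimately show ?thesis unfolding h_def P_def by linarith
qed

section \<open>Choice of parameters and conclusion\<close>

theorem theorem1p1:
  fixes b :: "nat \<Rightarrow> nat" and a B \<beta> :: "nat \<Rightarrow> real"
  assumes b_pos: "\<And>n. n \<ge> 1 \<Longrightarrow> b n > 0"
    and b_strict_mono: "strict_mono_on {1..} b"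
    and a_eq: "\<And>n. n \<ge> 1 \<Longrightarrow> a n = 1 / real (b n)"
    and diverges: "filterlim (\<lambda>N. \<Sum>n=1..N. a n) at_top sequentially"
    and b_bounds: "\<And>n. n \<ge> 2 \<Longrightarrow> n \<le> b n \<and> real (b n) \<le> real n * B n"
    and B_eq: "\<And>n. n \<ge> 2 \<Longrightarrow> B n = real n powr \<beta> n"
    and \<beta>_decreasing: "antimono_on {2..} \<beta>"
    and \<beta>_tendsto_0: "\<beta> \<longlonglongrightarrow> 0"
    and \<beta>_bound: "\<forall>\<^sub>F n in sequentially. \<beta> n \<le> 1 / (8 * ln (ln (real n)))"
  shows "\<exists>C>0. \<forall>\<tau>::real. \<forall>\<^sub>F N in sequentially.
           signed_sum_min a N \<tau> < exp (- C * (ln (real N))\<^sup>2)"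
proof (intro exI conjI allI)
  \<comment> \<open>Chosen so that T = exp ((ln N / 6000)^2) equals exp (3 C (ln N)^2); with
    \<delta> = exp (- C (ln N)^2) this gives T * \<delta>^2 = 1 / \<delta>.\<close>
  define C :: real where "C = 1 / (3 * 6000\<^sup>2)"
  show "C > 0" by (simp add: C_def)
  \<comment> \<open>Applied with c = 1 / (8 ln ln n) for large t and with c = 1/8 for small
    t.\<close>
  have b_powr: "real (b n) \<le> real n powr (1 + c)" if "n \<ge> 2" "\<beta> n \<le> c" for n c
  proof -
    have "real (b n) \<le> real n * real n powr \<beta> n" using b_bounds[of n] B_eq[of n] that by simp
    also have "\<dots> = real n powr (1 + \<beta> n)" using that by (simp add: powr_add)
    also have "\<dots> \<le> real n powr (1 + c)" using that by (intro powr_mono) auto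
    finally show ?thesis .
  qed
  have "\<forall>\<^sub>F n in sequentially. real (b n) \<le> exp (ln (real n) + ln (real n) / (8 * ln (ln (real n))))"
    using \<beta>_bound eventually_ge_at_top[of 2]
  proof eventually_elim
    case (elim n)
    then have "real (b n) \<le> real n powr (1 + 1 / (8 * ln (ln (real n))))" by (intro b_powr)
    also have "\<dots> = exp (ln (real n) + ln (real n) / (8 * ln (ln (real n))))"
      using elim by (simp add: powr_def algebra_simps)
    finally show ?case .
  qed
  from b_strict_mono b_pos this
  have large: "\<forall>\<^sub>F N in sequentially. \<forall>t. real N / 2 \<le> t \<longrightarrow> t \<le> exp ((ln (real N) / 6000)\<^sup>2) \<longrightarrow>
      \<bar>\<Prod>n\<in>{N div 2<..N}. cos (t / real (b n))\<bar> \<le> 1 / t\<^sup>2"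
    by (rule abs_prod_cos_eventually_le)
  have "\<forall>\<^sub>F n in sequentially. \<beta> n < 1 / 8" using \<beta>_tendsto_0 by (rule order_tendstoD) simp
  then obtain n1 where n1: "\<beta> n < 1 / 8" if "n \<ge> n1" for n by (auto simp: eventually_sequentially)
  have "\<forall>\<^sub>F t::real in at_top. exp (- ((2 * t) powr (3/4) / 128)) \<le> 1 / t\<^sup>2" by real_asymp
  then obtain t1 :: real where t1: "exp (- ((2 * t) powr (3/4) / 128)) \<le> 1 / t\<^sup>2" if "t \<ge> t1" for t
    by (auto simp: eventually_at_top_linorder)
  fix \<tau> :: real
  \<comment> \<open>M depends on \<tau> but not on N, whereas C, \<open>n1\<close> and
    \<open>t1\<close> were fixed before \<tau>. Hence only the threshold for N depends on
    \<tau>.\<close>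
  obtain M s1 where M: "M \<ge> max 16 (max n1 (nat \<lceil>t1\<rceil>))" and s1: "\<forall>n. s1 n \<in> {-1, 1::real}"
    and rem: "\<bar>\<tau> - (\<Sum>n=1..M. s1 n * a n)\<bar> \<le> a M"
    using exists_signs_remainder_le[OF _ diverges, of "max 16 (max n1 (nat \<lceil>t1\<rceil>))" \<tau>] a_eq by auto
  have M': "M \<ge> 16" "M \<ge> n1" "real M \<ge> t1" using M by linarith+
  define x where "x = \<tau> - (\<Sum>n=1..M. s1 n * a n)"
  have x: "\<bar>x\<bar> \<le> 1 / real M"
  proof -
    have "a M \<le> 1 / real M" using a_eq[of M] b_bounds[of M] M' by (auto intro!: divide_left_mono)
    then show ?thesis using rem by (simp add: x_def)
  qed
  have bM: "n \<le> b n \<and> real (b n) \<le> real n powr (9/8)" if "n > M" for n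
    using b_bounds[of n] b_powr[of n "1/8"] n1[of n] that M' by simp
  have "\<forall>\<^sub>F N::nat in sequentially. real M \<le> exp ((ln (real N) / 6000)\<^sup>2)" by real_asymp
  moreover have "\<forall>\<^sub>F N::nat in sequentially. exp (- (C * (ln (real N))\<^sup>2)) < 1 / 32"
    unfolding C_def by real_asymp
  ultimately show "\<forall>\<^sub>F N in sequentially. signed_sum_min a N \<tau> < exp (- C * (ln (real N))\<^sup>2)"
    using large eventually_ge_at_top[of "2 * M"]
  proof eventually_elim
    case (elim N)
    define T \<delta> where "T = exp ((ln (real N) / 6000)\<^sup>2)" and "\<delta> = exp (- (C * (ln (real N))\<^sup>2))"
    have T: "real M \<le> T" "T > 0" using elim by (auto simp: T_def)
    have T\<delta>: "T * \<delta>\<^sup>2 = 1 / \<delta>"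
      by (simp add: T_def \<delta>_def C_def power_divide field_simps flip: exp_double exp_add exp_minus)
    have prod: "(\<Prod>n\<in>{M<..N}. cos (t * a n)) = (\<Prod>n\<in>{M<..N}. cos (t / real (b n)))" for t
      using a_eq by (intro prod.cong) auto
    have "1 / 16 \<le> integral {0..T} (\<lambda>t. (1 - t / T) * (\<Prod>n\<in>{M<..N}. cos (t / real (b n))) * cos (t * x))"
    proof (rule integral_prod_cos_ge)
      fix t assume t: "real M \<le> t" "t \<le> T"
      show "\<bar>\<Prod>n\<in>{M<..N}. cos (t / real (b n))\<bar> \<le> 1 / t\<^sup>2"
      \<comment> \<open>If 2t <= N, the block (t, 2t] fits inside (M, N]. Otherwise the upper half
        of {1..N} is used, which lies in (M, N] because N >= 2 M.\<close>
      proof (cases "2 * t \<le> real N")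
        case True
        then have "\<bar>\<Prod>n\<in>{M<..N}. cos (t / real (b n))\<bar> \<le> exp (- ((2 * t) powr (3/4) / 128))"
          using t M' bM by (intro abs_prod_cos_le_small) auto
        also have "\<dots> \<le> 1 / t\<^sup>2" using t M' by (intro t1) auto
        finally show ?thesis .
      next
        case False
        have "{N div 2<..N} \<subseteq> {M<..N}" using elim by auto
        then have "\<bar>\<Prod>n\<in>{M<..N}. cos (t / real (b n))\<bar> \<le> \<bar>\<Prod>n\<in>{N div 2<..N}. cos (t / real (b n))\<bar>"
          by (intro abs_prod_cos_le_subset) auto
        also have "\<dots> \<le> 1 / t\<^sup>2" using elim(3) t False by (simp add: T_def)
        finally show ?thesis .
      qed
    qed (use bM M' elim T x in auto)
    moreover obtain s2 where s2: "\<forall>n. s2 n \<in> {-1, 1::real}" and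
      "integral {0..T} (\<lambda>t. (1 - t / T) * (\<Prod>n\<in>{M<..N}. cos (t * a n)) * cos (t * x))
        \<le> integral {0..T} (\<lambda>t. (1 - t / T) * cos (t * (x - (\<Sum>n\<in>{M<..N}. s2 n * a n))))"
    proof -
      have "continuous_on {0..T} (\<lambda>t. 1 - t / T)" using T by (intro continuous_intros) auto
      from exists_signs_integral_ge[OF finite_greaterThanAtMost this] show ?thesis using that by blast
    qed
    ultimately have ge: "1 / 16 \<le> integral {0..T} (\<lambda>t. (1 - t / T) * cos (t * (x - (\<Sum>n\<in>{M<..N}. s2 n * a n))))"
      by (simp add: prod)
    define y where "y = x - (\<Sum>n\<in>{M<..N}. s2 n * a n)"
    have y: "\<bar>y\<bar> < \<delta>"
    \<comment> \<open>If |y| >= \<delta>, the Fejer integral is at most 2 / (T * \<delta>^2) = 2 *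
      \<delta> < 1/16, against the lower bound \<open>ge\<close>.\<close>
    proof (rule ccontr)
      assume "\<not> \<bar>y\<bar> < \<delta>"
      then have "\<delta> \<le> \<bar>y\<bar>" by simp
      moreover have "\<delta> > 0" by (simp add: \<delta>_def)
      ultimately have "y \<noteq> 0" "\<delta>\<^sup>2 \<le> y\<^sup>2" using abs_le_square_iff[of \<delta> y] by auto
      have "1 / 16 \<le> (1 - cos (T * y)) / (T * y\<^sup>2)"
        using ge integral_fejer[OF \<open>y \<noteq> 0\<close> T(2)] by (simp add: y_def)
      also have "\<dots> \<le> 2 / (T * \<delta>\<^sup>2)"
        using T \<open>\<delta>\<^sup>2 \<le> y\<^sup>2\<close> \<open>\<delta> > 0\<close> cos_ge_minus_one[of "T * y"]
        by (intro frac_le mult_left_mono) auto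
      also have "\<dots> = 2 * \<delta>" by (simp add: T\<delta>)
      also have "\<dots> < 1 / 16" using elim(2) by (simp add: \<delta>_def)
      finally show False by simp
    qed
    \<comment> \<open>The restricted lambda makes \<open>s\<close> extensional, as membership in the
      sign space \<open>{1..N} \<rightarrow>\<^sub>E {-1, 1}\<close> demands.\<close>
    define s where "s = (\<lambda>n\<in>{1..N}. if n \<le> M then s1 n else s2 n)"
    have "(\<Sum>n=1..N. s n * a n) = (\<Sum>n=1..M. s1 n * a n) + (\<Sum>n\<in>{M<..N}. s2 n * a n)"
    proof -
      have "{1..N} = {1..M} \<union> {M<..N}" using elim M' by auto
      then have "(\<Sum>n=1..N. s n * a n) = (\<Sum>n=1..M. s n * a n) + (\<Sum>n\<in>{M<..N}. s n * a n)"
        by (simp only:, subst sum.union_disjoint) auto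
      then show ?thesis using elim by (simp add: s_def)
    qed
    then have "\<bar>(\<Sum>n=1..N. s n * a n) - \<tau>\<bar> = \<bar>y\<bar>" by (simp add: y_def x_def)
    moreover have "s \<in> {1..N} \<rightarrow>\<^sub>E {-1, 1}" using s1 s2 by (auto simp: s_def)
    ultimately have "\<bar>y\<bar> \<in> (\<lambda>s. \<bar>(\<Sum>n=1..N. s n * a n) - \<tau>\<bar>) ` ({1..N} \<rightarrow>\<^sub>E {-1, 1})"
      by (intro image_eqI) simp_all
    then have "signed_sum_min a N \<tau> \<le> \<bar>y\<bar>"
      unfolding signed_sum_min_def by (intro Min_le finite_imageI finite_PiE) auto
    then show ?case using y by (simp add: \<delta>_def)
  qed
qed

end
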